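(* Let $r \ge 1$ and let $H$ be an $r$-graph that maximises $P_2(\cdot)$ among $r$-graphs with the same number of edges (that is, $P_2(H) \ge P_2(H')$ for every $r$-graph $H'$ with $|H'| = |H|$). Then either $H$ is isomorphic to a subgraph of the clique $[r+1]^{(r)}$, or there is a set of $r-1$ vertices which is contained in every edge of $H$.
   Context: $\mathbb{N} = \{1,2,3,\dots\}$, $[t] = \{1,\dots,t\}$, and for a set $X$, $X^{(r)}$ denotes the family of all $r$-element subsets of $X$. An $r$-graph is a finite family $H \subseteq \mathbb{N}^{(r)}$; its members are its edges, and $|H|$ is the number of edges. Isomorphism is via relabelling of vertices (isolated vertices are ignored). The sum of degrees squared of $H$ is $P_2(H) := \sum_{x} d(x)^2$, where $d(x)$ is the number of edges of $H$ containing the vertex $x$. *)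

theory Defs
  imports "HOL-Library.Ramsey"
begin

text \<open>
  The natural numbers are \<open>{1, 2, 3, \<dots>}\<close>, i.e. \<open>{1..} :: nat set\<close>.
  The family of all \<open>r\<close>-element subsets of \<open>X\<close> is \<open>nsets X r\<close>.
\<close>

definition r_graph :: "nat \<Rightarrow> nat set set \<Rightarrow> bool" where
  "r_graph r H \<longleftrightarrow> finite H \<and> H \<subseteq> nsets {1..} r"

definition degree :: "nat set set \<Rightarrow> nat \<Rightarrow> nat" where
  "degree H x = card {e \<in> H. x \<in> e}"

text \<open>Vertices outside \<open>\<Union>H\<close> have degree 0, so the sum may be restricted to \<open>\<Union>H\<close>,
  which is finite for an \<open>r\<close>-graph.\<close>

definition P2 :: "nat set set \<Rightarrow> nat" where
  "P2 H = (\<Sum>x\<in>\<Union>H. (degree H x)\<^sup>2)"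

definition clique_r_graph :: "nat \<Rightarrow> nat \<Rightarrow> nat set set" where
  "clique_r_graph t r = nsets {1..t} r"

text \<open>Only the vertices lying in some edge are relabelled: isolated vertices are ignored.\<close>

definition isomorphic :: "nat set set \<Rightarrow> nat set set \<Rightarrow> bool" where
  "isomorphic H G \<longleftrightarrow> (\<exists>f. bij_betw f (\<Union>H) (\<Union>G) \<and> (\<lambda>e. f ` e) ` H = G)"

definition P2_maximal :: "nat \<Rightarrow> nat set set \<Rightarrow> bool" where
  "P2_maximal r H \<longleftrightarrow>
     r_graph r H \<and> (\<forall>H'. r_graph r H' \<and> card H' = card H \<longrightarrow> P2 H' \<le> P2 H)"

end

theory Submission
  imports Defs
begin

text \<open>
  Double counting gives \<open>P2 H = (\<Sum>e\<in>H. \<Sum>f\<in>H. card (e \<inter> f))\<close>, where distinct edges contribute at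
  most \<open>r - 1\<close>. Edges sharing a common \<open>(r - 1)\<close>-set attain this bound for every pair, so a
  maximiser of any size attains it as well. A family of \<open>r\<close>-sets which pairwise meet in \<open>r - 1\<close>
  points either has a common \<open>(r - 1)\<close>-subset or lives on \<open>r + 1\<close> points.
\<close>

text \<open>The square of \<open>degree H x\<close> counts ordered pairs of edges through
  \<open>x\<close>, equal ones included. Moving the sum over \<open>x\<close> innermost leaves, for
  each pair, the number of its common vertices.\<close>

lemma P2_eq_sum_card_Int:
  assumes "finite H" and fin: "\<And>e. e \<in> H \<Longrightarrow> finite e"
  shows "P2 H = (\<Sum>e\<in>H. \<Sum>f\<in>H. card (e \<inter> f))"
proof -
  have deg: "degree H x = (\<Sum>e\<in>H. if x \<in> e then 1 else 0)" for x
    using \<open>finite H\<close> by (simp add: degree_def sum.If_cases Int_def)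
  have U: "finite (\<Union>H)"
    using assms by blast
  have Int: "(\<Sum>x\<in>\<Union>H. if x \<in> e \<and> x \<in> f then 1 else 0) = card (e \<inter> f)" if "e \<in> H" for e f
  proof -
    have "\<Union>H \<inter> {x. x \<in> e \<and> x \<in> f} = e \<inter> f"
      using that by blast
    then show ?thesis
      using U by (simp add: sum.If_cases)
  qed
  have "P2 H = (\<Sum>x\<in>\<Union>H. \<Sum>e\<in>H. \<Sum>f\<in>H. if x \<in> e \<and> x \<in> f then 1 else 0)"
    unfolding P2_def deg power2_eq_square sum_product by (intro sum.cong refl) auto
  also have "\<dots> = (\<Sum>e\<in>H. \<Sum>x\<in>\<Union>H. \<Sum>f\<in>H. if x \<in> e \<and> x \<in> f then 1 else 0)"
    by (rule sum.swap)
  also have "\<dots> = (\<Sum>e\<in>H. \<Sum>f\<in>H. \<Sum>x\<in>\<Union>H. if x \<in> e \<and> x \<in> f then 1 else 0)"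
    by (intro sum.cong refl sum.swap)
  also have "\<dots> = (\<Sum>e\<in>H. \<Sum>f\<in>H. card (e \<inter> f))"
    by (intro sum.cong refl Int)
  finally show ?thesis .
qed

lemma card_Int_less_of_neq:
  assumes "finite e" "card e = r" "finite f" "card f = r" "e \<noteq> f"
  shows "card (e \<inter> f) < r"
proof -
  have "e \<inter> f \<noteq> e"
    using assms card_subset_eq[of f e] by (metis inf.cobounded2)
  then have "e \<inter> f \<subset> e"
    by blast
  then show ?thesis
    using psubset_card_mono[of e "e \<inter> f"] assms by simp
qed

text \<open>The value depends on \<open>H\<close> only through \<open>card H\<close>, which lets an
  upper bound for one family be compared with the exact value for another of the same size.\<close>

lemma sum_if_eq_const:
  fixes a b :: nat
  assumes "finite H"
  shows "(\<Sum>e\<in>H. \<Sum>f\<in>H. if e = f then a else b) = card H * (a + (card H - 1) * b)"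
proof -
  have "(\<Sum>f\<in>H. if e = f then a else b) = a + (card H - 1) * b" if "e \<in> H" for e
  proof -
    have "(\<Sum>f\<in>H. if e = f then a else b) = a + (\<Sum>f\<in>H - {e}. if e = f then a else b)"
      using assms that by (simp add: sum.remove)
    also have "(\<Sum>f\<in>H - {e}. if e = f then a else b) = (\<Sum>f\<in>H - {e}. b)"
      by (intro sum.cong) auto
    finally show ?thesis
      using assms that by simp
  qed
  then show ?thesis
    by simp
qed

text \<open>Supplies the competitor for a maximiser: a sunflower with kernel \<open>{1..<r}\<close>
  and \<open>m\<close> one-point petals.\<close>

lemma ex_r_graph_common_subset:
  assumes "r \<ge> 1"
  obtains K where "r_graph r K" "card K = m"
    "\<And>e f. e \<in> K \<Longrightarrow> f \<in> K \<Longrightarrow> e \<noteq> f \<Longrightarrow> card (e \<inter> f) = r - 1"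
proof
  let ?edge = "\<lambda>i. insert i {1..<r}"
  \<comment> \<open>The petals start at \<open>r\<close>, just past the kernel, so every edge has
    exactly \<open>r\<close> points, all positive because \<open>r \<ge> 1\<close>.\<close>
  let ?K = "?edge ` {r..<r + m}"
  show "r_graph r ?K"
    using assms by (auto simp: r_graph_def nsets_def)
  have "inj_on ?edge {r..<r + m}"
  proof (rule inj_onI)
    fix i j
    assume "i \<in> {r..<r + m}" and eq: "?edge i = ?edge j"
    then have "i \<notin> {1..<r}"
      by simp
    moreover have "i \<in> ?edge j"
      unfolding eq[symmetric] by simp
    ultimately show "i = j"
      by blast
  qed
  then show "card ?K = m"
    by (simp add: card_image)
  show "card (e \<inter> f) = r - 1" if ef: "e \<in> ?K" "f \<in> ?K" "e \<noteq> f" for e f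
  proof -
    have "e \<inter> f = {1..<r}"
      using ef by auto
    then show ?thesis
      by simp
  qed
qed

lemma P2_maximal_card_Int:
  assumes "r \<ge> 1" and max: "P2_maximal r H" and "e \<in> H" "f \<in> H" "e \<noteq> f"
  shows "card (e \<inter> f) = r - 1"
proof (rule ccontr)
  assume neq: "card (e \<inter> f) \<noteq> r - 1"
  \<comment> \<open>The largest intersection size possible for two \<open>r\<close>-sets; every pair
    in \<open>K\<close> attains it.\<close>
  let ?w = "\<lambda>e f. if e = f then r else r - 1"
  obtain K where K: "r_graph r K" "card K = card H"
    "\<And>e f. e \<in> K \<Longrightarrow> f \<in> K \<Longrightarrow> e \<noteq> f \<Longrightarrow> card (e \<inter> f) = r - 1"
    using ex_r_graph_common_subset[OF \<open>r \<ge> 1\<close>] by metis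
  have r_graphD: "finite G" "\<And>g. g \<in> G \<Longrightarrow> finite g" "\<And>g. g \<in> G \<Longrightarrow> card g = r"
    if "r_graph r G" for G
    using that by (auto simp: r_graph_def nsets_def)
  have H: "r_graph r H"
    using max by (simp add: P2_maximal_def)
  have w: "card (a \<inter> b) \<le> ?w a b" if "a \<in> H" "b \<in> H" for a b
    using card_Int_less_of_neq[of a r b] r_graphD[OF H] that by fastforce
  have "card (e \<inter> f) < ?w e f"
    using w[of e f] neq assms by simp
  \<comment> \<open>The deficient pair makes row \<open>e\<close> strictly smaller, and that row
    then makes the double sum strictly smaller.\<close>
  then have "(\<Sum>b\<in>H. card (e \<inter> b)) < (\<Sum>b\<in>H. ?w e b)"
    using r_graphD(1)[OF H] w assms by (intro sum_strict_mono_ex1) blast+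
  then have "(\<Sum>a\<in>H. \<Sum>b\<in>H. card (a \<inter> b)) < (\<Sum>a\<in>H. \<Sum>b\<in>H. ?w a b)"
    using r_graphD(1)[OF H] w \<open>e \<in> H\<close>
    by (intro sum_strict_mono_ex1 ballI sum_mono) blast+
  also have "\<dots> = (\<Sum>a\<in>K. \<Sum>b\<in>K. ?w a b)"
    using r_graphD(1)[OF H] r_graphD(1)[OF K(1)] K(2) by (simp add: sum_if_eq_const)
  also have "\<dots> = (\<Sum>a\<in>K. \<Sum>b\<in>K. card (a \<inter> b))"
    using K(3) r_graphD(3)[OF K(1)] by (intro sum.cong refl) auto
  finally have "P2 H < P2 K"
    using P2_eq_sum_card_Int r_graphD(1,2)[OF H] r_graphD(1,2)[OF K(1)] by simp
  then show False
    using max K(1,2) unfolding P2_maximal_def by (metis leD)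
qed

text \<open>An edge missing a point of \<open>e \<inter> f\<close> must be
  \<open>e \<union> f\<close> without that point, while an edge leaving \<open>e \<union> f\<close>
  must contain \<open>e \<inter> f\<close>. Edges of both kinds cannot coexist.\<close>

lemma pairwise_Int_dichotomy:
  assumes "r \<ge> 1" and fin: "\<And>e. e \<in> H \<Longrightarrow> finite e" and card: "\<And>e. e \<in> H \<Longrightarrow> card e = r"
    and Int: "\<And>e f. e \<in> H \<Longrightarrow> f \<in> H \<Longrightarrow> e \<noteq> f \<Longrightarrow> card (e \<inter> f) = r - 1"
    and ef: "e \<in> H" "f \<in> H" "e \<noteq> f"
  shows "(\<forall>h\<in>H. e \<inter> f \<subseteq> h) \<or> (\<forall>h\<in>H. h \<subseteq> e \<union> f)"
proof -
  \<comment> \<open>Since \<open>g\<close> shares \<open>r - 1\<close> points with \<open>u\<close>,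
    it can miss only one point of \<open>u\<close>, namely \<open>s\<close>.\<close>
  have meet: "u - {s} \<subseteq> g" if "g \<in> H" "u \<in> H" "s \<in> u" "s \<notin> g" for g u s
  proof -
    have "card (g \<inter> u) = card (u - {s})"
      using Int[of g u] card[OF \<open>u \<in> H\<close>] that by auto
    then have "g \<inter> u = u - {s}"
      using that fin by (intro card_subset_eq) auto
    then show ?thesis
      by blast
  qed
  have sub: "g \<subseteq> e \<union> f" if g: "g \<in> H" "\<not> e \<inter> f \<subseteq> g" for g
  proof -
    obtain s where s: "s \<in> e" "s \<in> f" "s \<notin> g"
      using g by blast
    have un: "(e \<union> f) - {s} \<subseteq> g"
      using meet[OF \<open>g \<in> H\<close> ef(1) s(1,3)] meet[OF \<open>g \<in> H\<close> ef(2) s(2,3)] by blast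
    have "card (e \<union> f) + card (e \<inter> f) = r + r"
      using card_Un_Int[of e f] fin card ef by simp
    \<comment> \<open>The union has \<open>r + 1\<close> points, so removing \<open>s\<close> leaves
      as many as \<open>g\<close> has, which forces equality.\<close>
    then have "card ((e \<union> f) - {s}) = r"
      using Int[OF ef] s \<open>r \<ge> 1\<close> by simp
    then have "(e \<union> f) - {s} = g"
      using un card fin g by (intro card_subset_eq) auto
    then show ?thesis
      by blast
  qed
  show ?thesis
  proof (rule disjCI)
    assume "\<not> (\<forall>h\<in>H. h \<subseteq> e \<union> f)"
    then obtain h c where h: "h \<in> H" "c \<in> h" "c \<notin> e \<union> f"
      by blast
    then have "e \<inter> f \<subseteq> h"
      using sub by blast
    show "\<forall>g\<in>H. e \<inter> f \<subseteq> g"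
    proof (rule ccontr)
      assume "\<not> (\<forall>g\<in>H. e \<inter> f \<subseteq> g)"
      then obtain g s where g: "g \<in> H" "s \<in> e \<inter> f" "s \<notin> g"
        by blast
      \<comment> \<open>Here \<open>s\<close> lies in \<open>h\<close> but not in \<open>g\<close>,
        so \<open>g\<close> contains the rest of \<open>h\<close>, including the outside point
        \<open>c\<close>. But missing \<open>s\<close> also confines \<open>g\<close> to
        \<open>e \<union> f\<close>.\<close>
      have "c \<in> g"
        using meet[of g h s] g h \<open>e \<inter> f \<subseteq> h\<close> by blast
      moreover have "g \<subseteq> e \<union> f"
        using sub g by blast
      ultimately show False
        using h by blast
    qed
  qed
qed

text \<open>A bijection from \<open>T\<close> to \<open>{1..t}\<close> relabels the vertices;
  \<open>G\<close> is taken to be the image of \<open>H\<close>, so the isomorphism holds by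
  construction.\<close>

lemma isomorphic_clique_subgraph:
  assumes "finite T" "card T = t" "\<Union>H \<subseteq> T" and card: "\<And>e. e \<in> H \<Longrightarrow> card e = r"
  shows "\<exists>G \<subseteq> clique_r_graph t r. isomorphic H G"
proof -
  obtain h where h: "bij_betw h T {1..t}"
    using assms(1,2) by (metis finite_same_card_bij finite_atLeastAtMost card_atLeastAtMost diff_Suc_1)
  have inj: "inj_on h (\<Union>H)"
    using h assms(3) by (meson bij_betw_def inj_on_subset)
  let ?G = "(\<lambda>e. h ` e) ` H"
  have "?G \<subseteq> clique_r_graph t r"
  proof
    fix g
    assume "g \<in> ?G"
    then obtain e where e: "e \<in> H" "g = h ` e"
      by blast
    then have "e \<subseteq> T" "inj_on h e"
      using assms(3) inj by (auto intro: inj_on_subset)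
    moreover have "h ` T = {1..t}"
      using h by (simp add: bij_betw_def)
    ultimately show "g \<in> clique_r_graph t r"
      using e card \<open>finite T\<close>
      by (auto simp: clique_r_graph_def nsets_def card_image intro: finite_subset)
  qed
  moreover have "isomorphic H ?G"
    unfolding isomorphic_def using inj by (intro exI[of _ h]) (auto simp: bij_betw_def)
  ultimately show ?thesis
    by blast
qed

theorem proposition1p5:
  fixes r :: nat and H :: "nat set set"
  assumes "r \<ge> 1"
    and "P2_maximal r H"
  shows "(\<exists>G \<subseteq> clique_r_graph (r + 1) r. isomorphic H G)
       \<or> (\<exists>S \<in> nsets {1..} (r - 1). \<forall>e\<in>H. S \<subseteq> e)"
proof -
  have H: "finite e" "card e = r" "e \<subseteq> {1..}" if "e \<in> H" for e
    using assms(2) that by (auto simp: P2_maximal_def r_graph_def nsets_def)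
  note Int = P2_maximal_card_Int[OF assms]
  \<comment> \<open>The dichotomy starts from two distinct edges. With at most one edge, a common
    \<open>(r - 1)\<close>-set is chosen directly.\<close>
  consider "H = {}" | e where "H = {e}" | e f where "e \<in> H" "f \<in> H" "e \<noteq> f"
    by blast
  then show ?thesis
  proof cases
    case 1
    have "{1..<r} \<in> nsets {1..} (r - 1)"
      by (auto simp: nsets_def)
    with 1 show ?thesis
      by blast
  next
    case 2
    then obtain S where "S \<subseteq> e" "card S = r - 1" "finite S"
      using H[of e] obtain_subset_with_card_n[of "r - 1" e] by auto
    then have "S \<in> nsets {1..} (r - 1)" "\<forall>e\<in>H. S \<subseteq> e"
      using 2 H(3)[of e] by (auto simp: nsets_def)
    then show ?thesis
      by blast
  next
    case 3
    have "(\<forall>h\<in>H. e \<inter> f \<subseteq> h) \<or> (\<forall>h\<in>H. h \<subseteq> e \<union> f)"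
      using pairwise_Int_dichotomy[of r H e f] assms(1) H Int 3 by blast
    then show ?thesis
    proof
      assume "\<forall>h\<in>H. e \<inter> f \<subseteq> h"
      moreover have "e \<inter> f \<in> nsets {1..} (r - 1)"
        using H 3 Int by (auto simp: nsets_def)
      ultimately show ?thesis
        by blast
    next
      assume "\<forall>h\<in>H. h \<subseteq> e \<union> f"
      moreover have "card (e \<union> f) = r + 1"
        using card_Un_Int[of e f] H 3 Int[of e f] assms(1) by simp
      ultimately show ?thesis
        using isomorphic_clique_subgraph[of "e \<union> f" "r + 1" H r] H 3 by blast
    qed
  qed
qed

end
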